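(* Let $k>0$ be a real number, and let $\alpha=\frac{k+\sqrt{k^2+4}}{2}$ and $\beta=\frac{k-\sqrt{k^2+4}}{2}$ be the roots of $t^2-kt-1=0$. For every integer $n\ge 1$, $$\mathbb{H}F_{k,n}=\frac{1}{\sqrt{k^2+4}}\left(\hat{\alpha}\,\alpha^n-\hat{\beta}\,\beta^n\right),$$ where $$\hat{\alpha}=1+\mathbf{i}\,(k-\beta)+\mathbf{j}\,[(k^2+1)-k\beta]+\mathbf{k}\,[(k^3+2k)-(k^2+1)\beta],$$ $$\hat{\beta}=1+\mathbf{i}\,(k-\alpha)+\mathbf{j}\,[(k^2+1)-k\alpha]+\mathbf{k}\,[(k^3+2k)-(k^2+1)\alpha].$$
   Context: For a real number $k>0$, the $k$-Fibonacci numbers are defined by $F_{k,0}=0$, $F_{k,1}=1$, $F_{k,n+1}=kF_{k,n}+F_{k,n-1}$ for $n\ge1$. The hyperbolic quaternions form the real four-dimensional algebra with basis $1,\mathbf{i},\mathbf{j},\mathbf{k}$, unit $1$, and bilinear product determined by $\mathbf{i}^2=\mathbf{j}^2=\mathbf{k}^2=1$, $\mathbf{i}\mathbf{j}=\mathbf{k}=-\mathbf{j}\mathbf{i}$, $\mathbf{j}\mathbf{k}=\mathbf{i}=-\mathbf{k}\mathbf{j}$, $\mathbf{k}\mathbf{i}=\mathbf{j}=-\mathbf{i}\mathbf{k}$. The unit $\mathbf{k}$ is distinct from the real parameter $k$. The $n$-th hyperbolic $k$-Fibonacci quaternion is $\mathbb{H}F_{k,n}=F_{k,n}+\mathbf{i}F_{k,n+1}+\mathbf{j}F_{k,n+2}+\mathbf{k}F_{k,n+3}$.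 *)

theory Defs
  imports Complex_Main
begin

fun kfib :: "real \<Rightarrow> nat \<Rightarrow> real" where
  "kfib k 0 = 0"
| "kfib k (Suc 0) = 1"
| "kfib k (Suc (Suc n)) = k * kfib k (Suc n) + kfib k n"

lemma kfib_recurrence: "n \<ge> 1 \<Longrightarrow> kfib k (n + 1) = k * kfib k n + kfib k (n - 1)"
  by (cases n) simp_all

text \<open>Coordinates with respect to the basis \<open>1, i, j, k\<close> of the hyperbolic quaternions.\<close>

codatatype hquat = HQuat (HRe: real) (HIm1: real) (HIm2: real) (HIm3: real)

lemma hquat_eqI:
  "\<lbrakk>HRe x = HRe y; HIm1 x = HIm1 y; HIm2 x = HIm2 y; HIm3 x = HIm3 y\<rbrakk> \<Longrightarrow> x = y"
  by (rule hquat.expand) simp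

instantiation hquat :: real_vector
begin

primcorec zero_hquat where
  "HRe 0 = 0" | "HIm1 0 = 0" | "HIm2 0 = 0" | "HIm3 0 = 0"

primcorec plus_hquat where
  "HRe (x + y) = HRe x + HRe y"
| "HIm1 (x + y) = HIm1 x + HIm1 y"
| "HIm2 (x + y) = HIm2 x + HIm2 y"
| "HIm3 (x + y) = HIm3 x + HIm3 y"

primcorec uminus_hquat where
  "HRe (- x) = - HRe x"
| "HIm1 (- x) = - HIm1 x"
| "HIm2 (- x) = - HIm2 x"
| "HIm3 (- x) = - HIm3 x"

primcorec minus_hquat where
  "HRe (x - y) = HRe x - HRe y"
| "HIm1 (x - y) = HIm1 x - HIm1 y"
| "HIm2 (x - y) = HIm2 x - HIm2 y"
| "HIm3 (x - y) = HIm3 x - HIm3 y"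

primcorec scaleR_hquat where
  "HRe (r *\<^sub>R x) = r * HRe x"
| "HIm1 (r *\<^sub>R x) = r * HIm1 x"
| "HIm2 (r *\<^sub>R x) = r * HIm2 x"
| "HIm3 (r *\<^sub>R x) = r * HIm3 x"

instance
  by standard (auto intro!: hquat_eqI simp: algebra_simps)

end

text \<open>
  The product is bilinear and unital but not associative: \<open>(i * i) * j = j\<close>, whereas
  \<open>i * (i * j) = - j\<close>. The type is therefore not an instance of
  \<^class>\<open>real_algebra_1\<close>, and \<^const>\<open>of_real\<close> is not available for it;
  a real number \<open>r\<close> is embedded as \<open>r *\<^sub>R 1\<close>.
\<close>

instantiation hquat :: "{one, times}"
begin

primcorec one_hquat where
  "HRe 1 = 1" | "HIm1 1 = 0" | "HIm2 1 = 0" | "HIm3 1 = 0"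

primcorec times_hquat where
  "HRe (x * y) = HRe x * HRe y + HIm1 x * HIm1 y + HIm2 x * HIm2 y + HIm3 x * HIm3 y"
| "HIm1 (x * y) = HRe x * HIm1 y + HIm1 x * HRe y + HIm2 x * HIm3 y - HIm3 x * HIm2 y"
| "HIm2 (x * y) = HRe x * HIm2 y + HIm2 x * HRe y + HIm3 x * HIm1 y - HIm1 x * HIm3 y"
| "HIm3 (x * y) = HRe x * HIm3 y + HIm3 x * HRe y + HIm1 x * HIm2 y - HIm2 x * HIm1 y"

instance ..

end

primcorec hq_i :: hquat where
  "HRe hq_i = 0" | "HIm1 hq_i = 1" | "HIm2 hq_i = 0" | "HIm3 hq_i = 0"

primcorec hq_j :: hquat where
  "HRe hq_j = 0" | "HIm1 hq_j = 0" | "HIm2 hq_j = 1" | "HIm3 hq_j = 0"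

primcorec hq_k :: hquat where
  "HRe hq_k = 0" | "HIm1 hq_k = 0" | "HIm2 hq_k = 0" | "HIm3 hq_k = 1"

lemma hquat_basis:
  "x = HRe x *\<^sub>R 1 + HIm1 x *\<^sub>R hq_i + HIm2 x *\<^sub>R hq_j + HIm3 x *\<^sub>R hq_k"
  by (rule hquat_eqI) simp_all

lemma hquat_mult_table:
  "hq_i * hq_i = 1" "hq_j * hq_j = 1" "hq_k * hq_k = 1"
  "hq_i * hq_j = hq_k" "hq_j * hq_i = - hq_k"
  "hq_j * hq_k = hq_i" "hq_k * hq_j = - hq_i"
  "hq_k * hq_i = hq_j" "hq_i * hq_k = - hq_j"
  by (auto intro!: hquat_eqI)

lemma hquat_mult_unit: "1 * x = x" "x * 1 = x" for x :: hquat
  by (auto intro!: hquat_eqI)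

lemma hquat_mult_bilinear:
  fixes x y z :: hquat
  shows "(x + y) * z = x * z + y * z" "x * (y + z) = x * y + x * z"
    and "(r *\<^sub>R x) * y = r *\<^sub>R (x * y)" "x * (r *\<^sub>R y) = r *\<^sub>R (x * y)"
  by (auto intro!: hquat_eqI simp: algebra_simps)

lemma hquat_mult_real: "x * (r *\<^sub>R 1) = r *\<^sub>R x" "(r *\<^sub>R 1) * x = r *\<^sub>R x" for x :: hquat
  by (simp_all add: hquat_mult_bilinear hquat_mult_unit)

definition HF :: "real \<Rightarrow> nat \<Rightarrow> hquat" where
  "HF k n = kfib k n *\<^sub>R 1 + kfib k (n + 1) *\<^sub>R hq_i
     + kfib k (n + 2) *\<^sub>R hq_j + kfib k (n + 3) *\<^sub>R hq_k"

lemma characteristic_roots: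
  fixes k t :: real
  shows "t\<^sup>2 - k * t - 1 = 0 \<longleftrightarrow>
    t = (k + sqrt (k\<^sup>2 + 4)) / 2 \<or> t = (k - sqrt (k\<^sup>2 + 4)) / 2"
proof -
  define s where "s = sqrt (k\<^sup>2 + 4)"
  have s: "s\<^sup>2 = k\<^sup>2 + 4" by (simp add: s_def)
  have "t\<^sup>2 - k * t - 1 = (t - (k + s) / 2) * (t - (k - s) / 2)"
    using s by (simp add: power2_eq_square field_simps)
  then show ?thesis by (simp add: s_def)
qed

end

(* Since beta = k - alpha and alpha^2 = k * alpha + 1, the coefficients of the first hat quaternion
   are 1, alpha, alpha^2, alpha^3, and symmetrically for beta. The claim is therefore the scalar
   Binet formula in each of the four coordinates. *)
theory Submission
  imports Defs
begin

text \<open>By the quadratic equations both power sequences obey the recurrence of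
  \<open>kfib k\<close>, so only the values at 0 and 1 need checking. Multiplying by
  \<open>a - b\<close> avoids division, so the roots need not be distinct here.\<close>

lemma kfib_binet:
  fixes a b k :: real
  assumes a: "a\<^sup>2 = k * a + 1" and b: "b\<^sup>2 = k * b + 1"
  shows "(a - b) * kfib k n = a ^ n - b ^ n"
proof (induction n rule: induct_nat_012)
  case (ge2 n)
  have "(a - b) * kfib k (Suc (Suc n)) =
      k * ((a - b) * kfib k (Suc n)) + (a - b) * kfib k n"
    by (simp add: algebra_simps)
  also have "\<dots> = (k * a + 1) * a ^ n - (k * b + 1) * b ^ n"
    unfolding ge2 by (simp add: algebra_simps)
  also have "\<dots> = a ^ Suc (Suc n) - b ^ Suc (Suc n)"
    unfolding a[symmetric] b[symmetric] by (simp add: power2_eq_square)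
  finally show ?case .
qed simp_all

text \<open>Powers of \<open>a\<close> are reduced to linear form modulo its quadratic equation.
  Keeping \<open>a\<close> generic with conjugate \<open>k - a\<close> lets one lemma serve both hat
  quaternions, with the roots swapped.\<close>

lemma root_powers:
  fixes a b k :: real
  assumes a: "a\<^sup>2 = k * a + 1" and b: "b = k - a"
  shows "k - b = a" "(k\<^sup>2 + 1) - k * b = a\<^sup>2" "(k ^ 3 + 2 * k) - (k\<^sup>2 + 1) * b = a ^ 3"
proof -
  show "k - b = a" "(k\<^sup>2 + 1) - k * b = a\<^sup>2"
    unfolding a b by (simp_all add: power2_eq_square algebra_simps)
  \<comment> \<open>The cube is first lowered to a quadratic in \<open>a\<close>, so that
    substituting for the square once more makes it linear.\<close>
  have "a ^ 3 = a * a\<^sup>2"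
    by (simp add: power3_eq_cube power2_eq_square)
  also have "\<dots> = a * (k * a + 1)"
    unfolding a ..
  also have "\<dots> = k * a\<^sup>2 + a"
    by (simp add: power2_eq_square algebra_simps)
  finally show "(k ^ 3 + 2 * k) - (k\<^sup>2 + 1) * b = a ^ 3"
    unfolding a b by (simp add: power3_eq_cube power2_eq_square algebra_simps)
qed

theorem theorem2p7:
  fixes k \<alpha> \<beta> :: real and \<alpha>_hat \<beta>_hat :: hquat and n :: nat
  assumes "k > 0"
    and "\<alpha> = (k + sqrt (k\<^sup>2 + 4)) / 2"
    and "\<beta> = (k - sqrt (k\<^sup>2 + 4)) / 2"
    and "\<alpha>_hat = 1 + (k - \<beta>) *\<^sub>R hq_i + ((k\<^sup>2 + 1) - k * \<beta>) *\<^sub>R hq_j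
           + ((k ^ 3 + 2 * k) - (k\<^sup>2 + 1) * \<beta>) *\<^sub>R hq_k"
    and "\<beta>_hat = 1 + (k - \<alpha>) *\<^sub>R hq_i + ((k\<^sup>2 + 1) - k * \<alpha>) *\<^sub>R hq_j
           + ((k ^ 3 + 2 * k) - (k\<^sup>2 + 1) * \<alpha>) *\<^sub>R hq_k"
    and "n \<ge> 1"
  shows "HF k n = (1 / sqrt (k\<^sup>2 + 4)) *\<^sub>R (\<alpha> ^ n *\<^sub>R \<alpha>_hat - \<beta> ^ n *\<^sub>R \<beta>_hat)"
proof -
  define s where "s = sqrt (k\<^sup>2 + 4)"
  \<comment> \<open>A positive discriminant makes the root difference \<open>s\<close> nonzero,
    which permits the division in \<open>fib\<close>.\<close>
  have "k\<^sup>2 + 4 > 0"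
    by (simp add: add_nonneg_pos)
  then have s: "s \<noteq> 0" "\<alpha> - \<beta> = s"
    by (simp_all add: s_def assms(2,3) field_simps)
  have "\<alpha>\<^sup>2 - k * \<alpha> - 1 = 0" "\<beta>\<^sup>2 - k * \<beta> - 1 = 0"
    unfolding characteristic_roots using assms(2,3) by blast+
  then have \<alpha>: "\<alpha>\<^sup>2 = k * \<alpha> + 1" and \<beta>: "\<beta>\<^sup>2 = k * \<beta> + 1"
    by simp_all
  have sum: "\<beta> = k - \<alpha>" "\<alpha> = k - \<beta>"
    by (simp_all add: assms(2,3) field_simps)
  have fib: "kfib k m = (\<alpha> ^ m - \<beta> ^ m) / s" for m
    using kfib_binet[OF \<alpha> \<beta>, of m] s by (simp add: field_simps)
  have \<alpha>_hat: "\<alpha>_hat = 1 + \<alpha> *\<^sub>R hq_i + \<alpha>\<^sup>2 *\<^sub>R hq_j + \<alpha> ^ 3 *\<^sub>R hq_k"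
    unfolding assms(4) root_powers[OF \<alpha> sum(1)] ..
  have \<beta>_hat: "\<beta>_hat = 1 + \<beta> *\<^sub>R hq_i + \<beta>\<^sup>2 *\<^sub>R hq_j + \<beta> ^ 3 *\<^sub>R hq_k"
    unfolding assms(5) root_powers[OF \<beta> sum(2)] ..
  \<comment> \<open>The coordinate of index m (from 0 to 3) on the right is (\<alpha>^n \<alpha>^m -
    \<beta>^n \<beta>^m) / \<open>s\<close>; merging exponents gives \<open>fib\<close> at n +
    m.\<close>
  show ?thesis
    unfolding HF_def fib \<alpha>_hat \<beta>_hat s_def[symmetric]
    by (rule hquat_eqI) (simp_all add: power_add power2_eq_square)
qed

end
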